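(* Let $\ell\geq 3$, let $V=\mathbb{C}^\ell$, let $S=\mathbb{C}[z_1,\ldots,z_\ell]$, and let $\mathcal{A}_1$ and $\mathcal{A}_2$ be two central and essential hyperplane arrangements in $V$. Then $\mathcal{A}_1$ and $\mathcal{A}_2$ are identical if and only if the Jacobian schemes $\operatorname{Proj} S/J(\mathcal{A}_1)$ and $\operatorname{Proj} S/J(\mathcal{A}_2)$ are equal as closed subschemes of $\mathbb{CP}^{\ell-1}$.
   Context: Let $V=\mathbb{C}^\ell$, with the symmetric algebra $S(V^* )$ identified with the polynomial ring $S=\mathbb{C}[z_1,\ldots,z_\ell]$. A hyperplane in $V$ is a codimension one affine subspace. A hyperplane arrangement in $V$ is a finite collection (set) $\mathcal{A}$ of (distinct) hyperplanes in $V$. It is central if every $H\in\mathcal{A}$ contains the origin, and a central arrangement is essential if $\bigcap_{H\in\mathcal{A}}H=\{0\}$. For a central arrangement $\mathcal{A}$, choose for each $H\in\mathcal{A}$ a linear form $\alpha_H\in S$ with $H=\ker\alpha_H$; the defining polynomial is $Q=\prod_{H\in\mathcal{A}}\alpha_H$, which is well defined up to a nonzero constant. The Jacobian ideal of $\mathcal{A}$ is the homogeneous ideal $$J(\mathcal{A})=J(Q)=\left(\frac{\partial Q}{\partial z_1},\ldots,\frac{\partial Q}{\partial z_\ell}\right)\subseteq S,$$ and the closed subscheme $\operatorname{Proj} S/J(\mathcal{A})$ of $\mathbb{CP}^{\ell-1}=\operatorname{Proj} S$ is the Jacobian scheme of $\mathcal{A}$. Two arrangements $\mathcal{A}_1,\mathcal{A}_2$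 with defining polynomials $Q_1,Q_2$ are called identical if $Q_1=cQ_2$ for some $c\in\mathbb{C}^*$. *)

theory Defs
  imports "HOL-Analysis.Analysis" "HOL-Library.Poly_Mapping"
begin

section \<open>The graded polynomial ring\<close>

text \<open>
  The index type \<open>'n\<close> plays the role of \<open>{1,\<dots>,\<ell>}\<close>: monomials are finitely supported
  functions \<open>'n \<Rightarrow>\<^sub>0 nat\<close>, and the ring structure on \<open>S = \<complex>[z\<^sub>i | i \<in> 'n]\<close> is the convolution
  product provided by the library for \<open>\<Rightarrow>\<^sub>0\<close>.
\<close>

type_synonym 'n cpoly = "('n \<Rightarrow>\<^sub>0 nat) \<Rightarrow>\<^sub>0 complex"

definition const :: "complex \<Rightarrow> 'n cpoly" where
  "const c = Poly_Mapping.single 0 c"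

definition mdeg :: "('n::finite \<Rightarrow>\<^sub>0 nat) \<Rightarrow> nat" where
  "mdeg m = (\<Sum>i\<in>UNIV. Poly_Mapping.lookup m i)"

definition poly_eval :: "'n::finite cpoly \<Rightarrow> complex ^ 'n \<Rightarrow> complex" where
  "poly_eval p v = (\<Sum>m\<in>Poly_Mapping.keys p.
     Poly_Mapping.lookup p m * (\<Prod>i\<in>UNIV. (v $ i) ^ Poly_Mapping.lookup m i))"

text \<open>The zero polynomial is homogeneous of every degree.\<close>

definition homogeneous :: "nat \<Rightarrow> 'n::finite cpoly \<Rightarrow> bool" where
  "homogeneous d p \<longleftrightarrow> (\<forall>m\<in>Poly_Mapping.keys p. mdeg m = d)"

definition hom_component :: "nat \<Rightarrow> 'n::finite cpoly \<Rightarrow> 'n cpoly" where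
  "hom_component d p = (\<Sum>m\<in>{m \<in> Poly_Mapping.keys p. mdeg m = d}.
     Poly_Mapping.single m (Poly_Mapping.lookup p m))"

text \<open>In the next definition a monomial not involving \<open>z\<^sub>i\<close> contributes coefficient \<open>0\<close>, so the
  truncated subtraction of exponents is harmless.\<close>

definition partial_deriv :: "'n \<Rightarrow> 'n cpoly \<Rightarrow> 'n cpoly" where
  "partial_deriv i p = (\<Sum>m\<in>Poly_Mapping.keys p.
     Poly_Mapping.single (m - Poly_Mapping.single i 1)
       (of_nat (Poly_Mapping.lookup m i) * Poly_Mapping.lookup p m))"

text \<open>Ideals are the submodules of the ring regarded as a module over itself.\<close>

definition ring_ideal :: "'a::comm_ring_1 set \<Rightarrow> bool" where
  "ring_ideal = module.subspace (*)"

definition ideal_generated :: "'a::comm_ring_1 set \<Rightarrow> 'a set" where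
  "ideal_generated = module.span (*)"

lemma module_self: "module ((*) :: 'a::comm_ring_1 \<Rightarrow> 'a \<Rightarrow> 'a)"
  by unfold_locales (simp_all add: algebra_simps)

lemma ring_ideal_iff:
  "ring_ideal I \<longleftrightarrow> 0 \<in> I \<and> (\<forall>x\<in>I. \<forall>y\<in>I. x + y \<in> I) \<and> (\<forall>r. \<forall>x\<in>I. r * x \<in> I)"
  unfolding ring_ideal_def module.subspace_def[OF module_self] by blast

lemma ideal_generated_least:
  "ring_ideal (ideal_generated B)" "B \<subseteq> ideal_generated B"
  "\<lbrakk>ring_ideal I; B \<subseteq> I\<rbrakk> \<Longrightarrow> ideal_generated B \<subseteq> I"
  unfolding ring_ideal_def ideal_generated_def
  by (rule module.subspace_span[OF module_self] module.span_superset[OF module_self]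
        module.span_minimal[OF module_self]; assumption)+

definition prime_ideal :: "'a::comm_ring_1 set \<Rightarrow> bool" where
  "prime_ideal P \<longleftrightarrow> ring_ideal P \<and> P \<noteq> UNIV \<and> (\<forall>a b. a * b \<in> P \<longrightarrow> a \<in> P \<or> b \<in> P)"

definition homogeneous_ideal :: "'n::finite cpoly set \<Rightarrow> bool" where
  "homogeneous_ideal I \<longleftrightarrow> ring_ideal I \<and> (\<forall>p\<in>I. \<forall>d. hom_component d p \<in> I)"

definition irrelevant_ideal :: "'n::finite cpoly set" where
  "irrelevant_ideal = {p. hom_component 0 p = 0}"


section \<open>Closed subschemes of projective space\<close>

text \<open>
  Let \<open>J\<close> be a homogeneous ideal of \<open>S\<close>. The scheme \<open>Proj S/J\<close> is written down through the
  correspondence between ideals of \<open>S/J\<close> and ideals of \<open>S\<close> containing \<open>J\<close>: its points are the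
  homogeneous primes of \<open>S\<close> that contain \<open>J\<close> but not the irrelevant ideal. In particular
  \<open>Proj S\<close> itself is the case \<open>J = {0}\<close>, and the closed immersion \<open>Proj S/J \<rightarrow> Proj S\<close> is an
  inclusion on points.
\<close>

definition proj_points :: "'n::finite cpoly set \<Rightarrow> 'n cpoly set set" where
  "proj_points J = {P. homogeneous_ideal P \<and> prime_ideal P \<and> J \<subseteq> P \<and> \<not> irrelevant_ideal \<subseteq> P}"

definition proj_open :: "'n::finite cpoly set \<Rightarrow> 'n cpoly set set \<Rightarrow> bool" where
  "proj_open J U \<longleftrightarrow> (\<exists>I. homogeneous_ideal I \<and> U = {P \<in> proj_points J. \<not> I \<subseteq> P})"

text \<open>
  \<open>proj_frac J P a f\<close> is the element \<open>a/f\<close> of the degree zero localization \<open>(S/J)\<^bsub>(P)\<^esub>\<close>, for \<open>a\<close>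
  and \<open>f \<notin> P\<close> homogeneous of the same degree. Elements of the localization are represented as
  equivalence classes of pairs; the pairs consist of representatives in \<open>S\<close> of homogeneous
  elements of \<open>S/J\<close>.
\<close>

definition proj_frac ::
    "'n::finite cpoly set \<Rightarrow> 'n cpoly set \<Rightarrow> 'n cpoly \<Rightarrow> 'n cpoly \<Rightarrow> ('n cpoly \<times> 'n cpoly) set" where
  "proj_frac J P a f = {(b, g). (\<exists>d. homogeneous d b \<and> homogeneous d g) \<and> g \<notin> P \<and>
     (\<exists>e h. homogeneous e h \<and> h \<notin> P \<and> h * (a * g - b * f) \<in> J)}"

text \<open>
  Sections of the structure sheaf of \<open>Proj S/J\<close> over an open set \<open>U\<close>: functions to the local
  rings \<open>(S/J)\<^bsub>(P)\<^esub>\<close> that are locally given by a single fraction.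
\<close>

definition proj_sections ::
    "'n::finite cpoly set \<Rightarrow> 'n cpoly set set \<Rightarrow> ('n cpoly set \<Rightarrow> ('n cpoly \<times> 'n cpoly) set) set" where
  "proj_sections J U = {s \<in> extensional U. \<forall>P\<in>U. \<exists>W. proj_open J W \<and> P \<in> W \<and> W \<subseteq> U \<and>
     (\<exists>d a f. homogeneous d a \<and> homogeneous d f \<and>
        (\<forall>P'\<in>W. f \<notin> P' \<and> s P' = proj_frac J P' a f))}"

text \<open>
  For the closed immersion \<open>\<iota> : Proj S/J \<rightarrow> Proj S\<close> the comorphism
  \<open>\<O>(U) \<rightarrow> (\<iota>\<^sub>* \<O>)(U) = \<O>(U \<inter> proj_points J)\<close> is induced by the maps
  \<open>S\<^bsub>(P)\<^esub> \<rightarrow> (S/J)\<^bsub>(P)\<^esub>\<close>, \<open>a/f \<mapsto> a/f\<close>. Below, \<open>c\<close> is a class of pairs, and all members of \<open>c\<close>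
  have the same image class.
\<close>

definition proj_stalk_map ::
    "'n::finite cpoly set \<Rightarrow> 'n cpoly set \<Rightarrow> ('n cpoly \<times> 'n cpoly) set \<Rightarrow> ('n cpoly \<times> 'n cpoly) set" where
  "proj_stalk_map J P c = (\<Union>(a, f)\<in>c. proj_frac J P a f)"

definition proj_comorphism ::
    "'n::finite cpoly set \<Rightarrow> 'n cpoly set set \<Rightarrow> ('n cpoly set \<Rightarrow> ('n cpoly \<times> 'n cpoly) set) \<Rightarrow>
     'n cpoly set \<Rightarrow> ('n cpoly \<times> 'n cpoly) set" where
  "proj_comorphism J U s = (\<lambda>P \<in> U \<inter> proj_points J. proj_stalk_map J P (s P))"

text \<open>
  A closed subscheme of \<open>Proj S\<close> is determined by its closed set of points together with its
  ideal sheaf, the kernel of \<open>\<O> \<rightarrow> \<iota>\<^sub>* \<O>\<close>; two closed subschemes are equal precisely when these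
  data coincide. The ideal sheaf is given the dummy value \<open>{}\<close> on sets that are not open.
\<close>

record 'n closed_subscheme =
  support :: "'n cpoly set set"
  ideal_sheaf :: "'n cpoly set set \<Rightarrow> ('n cpoly set \<Rightarrow> ('n cpoly \<times> 'n cpoly) set) set"

definition Proj_quotient :: "'n::finite cpoly set \<Rightarrow> 'n closed_subscheme" where
  "Proj_quotient J = \<lparr>support = proj_points J,
     ideal_sheaf = (\<lambda>U. if proj_open {0} U
       then {s \<in> proj_sections {0} U.
               proj_comorphism J U s = (\<lambda>P \<in> U \<inter> proj_points J. proj_frac J P 0 1)}
       else {})\<rparr>"


section \<open>Hyperplane arrangements\<close>

definition hyperplane :: "(complex ^ 'n::finite) set \<Rightarrow> bool" where
  "hyperplane H \<longleftrightarrow> (\<exists>v W. vec.subspace W \<and> vec.dim W + 1 = CARD('n) \<and> H = (+) v ` W)"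

definition arrangement :: "(complex ^ 'n::finite) set set \<Rightarrow> bool" where
  "arrangement A \<longleftrightarrow> finite A \<and> (\<forall>H\<in>A. hyperplane H)"

definition central :: "(complex ^ 'n::finite) set set \<Rightarrow> bool" where
  "central A \<longleftrightarrow> (\<forall>H\<in>A. 0 \<in> H)"

definition essential :: "(complex ^ 'n::finite) set set \<Rightarrow> bool" where
  "essential A \<longleftrightarrow> \<Inter>A = {0}"

text \<open>Linear forms are the homogeneous polynomials of degree one.\<close>

definition is_form_of :: "(complex ^ 'n::finite) set \<Rightarrow> 'n cpoly \<Rightarrow> bool" where
  "is_form_of H \<alpha> \<longleftrightarrow> homogeneous 1 \<alpha> \<and> H = {v. poly_eval \<alpha> v = 0}"

definition defining_form :: "(complex ^ 'n::finite) set \<Rightarrow> 'n cpoly" where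
  "defining_form H = (SOME \<alpha>. is_form_of H \<alpha>)"

definition defining_poly :: "(complex ^ 'n::finite) set set \<Rightarrow> 'n cpoly" where
  "defining_poly A = (\<Prod>H\<in>A. defining_form H)"

definition identical :: "(complex ^ 'n::finite) set set \<Rightarrow> (complex ^ 'n) set set \<Rightarrow> bool" where
  "identical A B \<longleftrightarrow> (\<exists>c. c \<noteq> 0 \<and> defining_poly A = const c * defining_poly B)"

definition jacobian_ideal :: "(complex ^ 'n::finite) set set \<Rightarrow> 'n cpoly set" where
  "jacobian_ideal A = ideal_generated (range (\<lambda>i. partial_deriv i (defining_poly A)))"

definition jacobian_scheme :: "(complex ^ 'n::finite) set set \<Rightarrow> 'n closed_subscheme" where
  "jacobian_scheme A = Proj_quotient (jacobian_ideal A)"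


subsection \<open>The choice of linear forms is possible and immaterial\<close>

lemma hyperplane_through_0:
  fixes H :: "(complex ^ 'n::finite) set"
  assumes "hyperplane H" "0 \<in> H"
  shows "vec.subspace H" "vec.dim H + 1 = CARD('n)"
proof -
  obtain v W where W: "vec.subspace W" "vec.dim W + 1 = CARD('n)" "H = (+) v ` W"
    using assms(1) unfolding hyperplane_def by blast
  then obtain w where "w \<in> W" "v + w = 0" using assms(2) by auto
  then have v: "v \<in> W"
    using vec.subspace_neg[OF W(1), of w] by (simp add: add_eq_0_iff2)
  have "H = W"
  proof
    show "H \<subseteq> W" using W v by (auto intro: vec.subspace_add)
    show "W \<subseteq> H"
    proof
      fix x assume "x \<in> W"
      then have "x - v \<in> W" using W(1) v vec.subspace_diff by blast
      then show "x \<in> H" unfolding W(3) by (intro image_eqI[of _ _ "x - v"]) auto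
    qed
  qed
  then show "vec.subspace H" "vec.dim H + 1 = CARD('n)" using W by auto
qed

lemma mdeg_eq_1_iff:
  fixes m :: "'n::finite \<Rightarrow>\<^sub>0 nat"
  shows "mdeg m = 1 \<longleftrightarrow> (\<exists>i. m = Poly_Mapping.single i 1)"
proof
  assume "mdeg m = 1"
  then have "\<exists>i. Poly_Mapping.lookup m i = 1 \<and> (\<forall>j. j \<noteq> i \<longrightarrow> Poly_Mapping.lookup m j = 0)"
    unfolding mdeg_def by (subst (asm) sum_eq_1_iff) auto
  then show "\<exists>i. m = Poly_Mapping.single i 1"
    by (metis lookup_single_eq lookup_single_not_eq poly_mapping_eqI)
next
  assume "\<exists>i. m = Poly_Mapping.single i 1"
  then show "mdeg m = 1" unfolding mdeg_def by (auto simp: lookup_single when_def)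
qed

lemma poly_eval_linear_form:
  assumes "homogeneous 1 \<alpha>"
  shows "poly_eval \<alpha> v = (\<Sum>i\<in>UNIV. Poly_Mapping.lookup \<alpha> (Poly_Mapping.single i 1) * v $ i)"
proof -
  let ?t = "\<lambda>m. Poly_Mapping.lookup \<alpha> m * (\<Prod>i\<in>UNIV. (v $ i) ^ Poly_Mapping.lookup m i)"
  let ?s = "\<lambda>i. Poly_Mapping.single i (1::nat)"
  have inj: "inj ?s" by (metis (no_types, lifting) injI keys_single one_neq_zero singleton_inject)
  have sub: "Poly_Mapping.keys \<alpha> \<subseteq> range ?s"
    using assms unfolding homogeneous_def mdeg_eq_1_iff by auto
  have "poly_eval \<alpha> v = sum ?t (range ?s)"
    unfolding poly_eval_def by (rule sum.mono_neutral_left) (use sub in \<open>auto simp: in_keys_iff\<close>)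
  also have "\<dots> = (\<Sum>i\<in>UNIV. ?t (?s i))"
    using sum.reindex[OF inj, of ?t] by simp
  also have "\<dots> = (\<Sum>i\<in>UNIV. Poly_Mapping.lookup \<alpha> (?s i) * v $ i)"
  proof (rule sum.cong[OF refl])
    fix i
    have "(\<Prod>j\<in>UNIV. (v $ j) ^ Poly_Mapping.lookup (?s i) j) = (\<Prod>j\<in>UNIV. if j = i then v $ j else 1)"
      by (rule prod.cong) (auto simp: lookup_single when_def)
    then show "?t (?s i) = Poly_Mapping.lookup \<alpha> (?s i) * v $ i" by simp
  qed
  finally show ?thesis .
qed

lemma form_exists:
  fixes H :: "(complex ^ 'n::finite) set"
  assumes "hyperplane H" "0 \<in> H"
  shows "\<exists>\<alpha>. is_form_of H \<alpha>"
proof -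
  let ?s = "\<lambda>i::'n. Poly_Mapping.single i (1::nat)"
  note H = hyperplane_through_0[OF assms]
  obtain B where B: "B \<subseteq> H" "vec.independent B" "H \<subseteq> vec.span B" "card B = vec.dim H"
    using vec.basis_exists by blast
  have spanB: "vec.span B = H"
    using B H(1) vec.span_minimal[OF B(1) H(1)] by blast
  have "H \<noteq> UNIV"
  proof
    assume "H = UNIV"
    then have "vec.dim H = CARD('n)" using vec_dim_card by metis
    with H(2) show False by simp
  qed
  then obtain x0 where x0: "x0 \<notin> H" by blast
  have indep: "vec.independent (insert x0 B)"
    using B(2) x0 spanB by (intro vec.independent_insertI) auto
  have "x0 \<notin> B" using x0 B(1) by blast
  moreover have "finite B" using B(2) by (rule vec.finiteI_independent)
  ultimately have "card (insert x0 B) = CARD('n)" using B(4) H(2) by simp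
  then have "vec.dim (UNIV :: (complex^'n) set) \<le> card (insert x0 B)"
    using vec_dim_card[where 'a = complex and 'n = 'n] by simp
  then have span: "vec.span (insert x0 B) = UNIV"
    using vec.card_ge_dim_independent[OF subset_UNIV indep] by auto
  obtain k :: 'n where True by blast
  obtain g :: "complex^'n \<Rightarrow> complex^'n"
    where g: "Vector_Spaces.linear (*s) (*s) g"
      "\<And>b. b \<in> insert x0 B \<Longrightarrow> g b = (if b = x0 then axis k 1 else 0)"
    using vec.linear_independent_extend[OF indep, of "\<lambda>b. if b = x0 then axis k 1 else 0"]
    by blast
  interpret g: Vector_Spaces.linear "(*s)" "(*s)" g by (rule g(1))
  have gB: "g h = 0" if "h \<in> H" for h
  proof (rule g.eq_0_on_span)
    show "h \<in> vec.span B" using that spanB by simp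
    show "g b = 0" if "b \<in> B" for b using g(2)[of b] that \<open>x0 \<notin> B\<close> by auto
  qed
  have gk: "g x $ k = 0 \<longleftrightarrow> x \<in> H" for x
  proof -
    obtain c where c: "x - c *s x0 \<in> H"
      using span vec.span_breakdown_eq[of x x0 B] spanB by auto
    have "g x = c *s axis k 1"
      using gB[OF c] g(2)[of x0] by (simp add: g.diff g.scale)
    then have gx: "g x $ k = c" by simp
    show ?thesis
    proof
      assume "g x $ k = 0"
      then show "x \<in> H" using c gx by simp
    qed (use gB in simp)
  qed
  define \<alpha> :: "'n cpoly" where "\<alpha> = (\<Sum>i\<in>UNIV. Poly_Mapping.single (?s i) (matrix g $ k $ i))"
  have inj: "?s i = ?s j \<longleftrightarrow> i = j" for i j
    by (metis lookup_single_eq lookup_single_not_eq one_neq_zero)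
  have coeff: "Poly_Mapping.lookup \<alpha> (?s j) = matrix g $ k $ j" for j
    unfolding \<alpha>_def by (simp add: lookup_sum lookup_single when_def inj[simplified])
  have hom: "homogeneous 1 \<alpha>"
    unfolding homogeneous_def
  proof
    fix m assume m: "m \<in> Poly_Mapping.keys \<alpha>"
    then have "\<exists>i. m = ?s i"
    proof (rule contrapos_pp)
      assume "\<nexists>i. m = ?s i"
      then have "Poly_Mapping.lookup \<alpha> m = 0"
        unfolding \<alpha>_def by (auto simp: lookup_sum lookup_single when_def intro!: sum.neutral)
      then show "m \<notin> Poly_Mapping.keys \<alpha>" by (simp add: in_keys_iff)
    qed
    then show "mdeg m = 1" unfolding mdeg_eq_1_iff .
  qed
  have "poly_eval \<alpha> v = g v $ k" for v
  proof -
    have "g v = matrix g *v v" using matrix_works[OF g(1)] by simp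
    then show ?thesis
      unfolding poly_eval_linear_form[OF hom] coeff by (simp add: matrix_vector_mult_def)
  qed
  then have "is_form_of H \<alpha>" using hom gk unfolding is_form_of_def by auto
  then show ?thesis ..
qed

lemma defining_form:
  assumes "hyperplane H" "0 \<in> H"
  shows "is_form_of H (defining_form H)"
  unfolding defining_form_def using form_exists[OF assms] by (rule someI_ex)

lemma lookup_const_mult: "Poly_Mapping.lookup (const c * p) m = c * Poly_Mapping.lookup p m"
proof -
  have "const c * p = Poly_Mapping.map ((*) c) p"
    unfolding const_def by (rule mult_map_scale_conv_mult[symmetric])
  then show ?thesis by (simp add: map.rep_eq when_def)
qed

lemma form_unique:
  fixes H :: "(complex ^ 'n::finite) set"
  assumes "hyperplane H" "0 \<in> H" "is_form_of H \<alpha>" "is_form_of H \<beta>"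
  shows "\<exists>c. c \<noteq> 0 \<and> \<alpha> = const c * \<beta>"
proof -
  let ?s = "\<lambda>i::'n. Poly_Mapping.single i (1::nat)"
  have hom: "homogeneous 1 \<alpha>" "homogeneous 1 \<beta>"
    and H: "\<And>v. v \<in> H \<longleftrightarrow> poly_eval \<alpha> v = 0" "\<And>v. v \<in> H \<longleftrightarrow> poly_eval \<beta> v = 0"
    using assms unfolding is_form_of_def by auto
  have "H \<noteq> UNIV"
    using hyperplane_through_0(2)[OF assms(1,2)] vec_dim_card[where 'a = complex and 'n = 'n] by auto
  then obtain x where "x \<notin> H" by blast
  then have x: "poly_eval \<alpha> x \<noteq> 0" "poly_eval \<beta> x \<noteq> 0" using H by auto
  have lin: "poly_eval \<gamma> (u - t *s w) = poly_eval \<gamma> u - t * poly_eval \<gamma> w"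
    if "homogeneous 1 \<gamma>" for \<gamma> :: "'n cpoly" and t and u w :: "complex ^ 'n"
    unfolding poly_eval_linear_form[OF that]
    by (simp add: sum_subtractf[symmetric] sum_distrib_left algebra_simps)
  define c where "c = poly_eval \<alpha> x / poly_eval \<beta> x"
  have scale: "poly_eval \<alpha> v = c * poly_eval \<beta> v" for v
  proof -
    let ?t = "poly_eval \<beta> v / poly_eval \<beta> x"
    have "poly_eval \<beta> (v - ?t *s x) = 0" unfolding lin[OF hom(2)] using x by simp
    then have "poly_eval \<alpha> (v - ?t *s x) = 0" using H by blast
    then show ?thesis unfolding lin[OF hom(1)] c_def by simp
  qed
  have ax: "poly_eval \<gamma> (axis i 1) = Poly_Mapping.lookup \<gamma> (?s i)"
    if "homogeneous 1 \<gamma>" for \<gamma> :: "'n cpoly" and i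
    unfolding poly_eval_linear_form[OF that] by (simp add: axis_def if_distrib cong: if_cong)
  have "\<alpha> = const c * \<beta>"
  proof (rule poly_mapping_eqI)
    fix m
    show "Poly_Mapping.lookup \<alpha> m = Poly_Mapping.lookup (const c * \<beta>) m"
    proof (cases "mdeg m = 1")
      case True
      then obtain i where "m = ?s i" unfolding mdeg_eq_1_iff by blast
      then show ?thesis using scale[of "axis i 1"] ax hom by (simp add: lookup_const_mult)
    next
      case False
      then have "m \<notin> Poly_Mapping.keys \<alpha>" "m \<notin> Poly_Mapping.keys \<beta>"
        using hom unfolding homogeneous_def by auto
      then show ?thesis by (simp add: lookup_const_mult in_keys_iff)
    qed
  qed
  moreover have "c \<noteq> 0" using x unfolding c_def by simp
  ultimately show ?thesis by blast
qed

lemma defining_poly_unique: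
  fixes A :: "(complex ^ 'n::finite) set set"
  assumes "arrangement A" "central A" "\<And>H. H \<in> A \<Longrightarrow> is_form_of H (\<alpha> H)"
  shows "\<exists>c. c \<noteq> 0 \<and> (\<Prod>H\<in>A. \<alpha> H) = const c * defining_poly A"
proof -
  have A: "finite A" "\<And>H. H \<in> A \<Longrightarrow> hyperplane H \<and> 0 \<in> H"
    using assms unfolding arrangement_def central_def by auto
  have "\<exists>c. c \<noteq> 0 \<and> (\<Prod>H\<in>B. \<alpha> H) = const c * (\<Prod>H\<in>B. defining_form H)" if "B \<subseteq> A" for B
    using finite_subset[OF that A(1)] that
  proof (induction B rule: finite_induct)
    case empty
    show ?case by (rule exI[of _ 1]) (simp add: const_def)
  next
    case (insert H B)
    then obtain c where c: "c \<noteq> 0" "(\<Prod>H\<in>B. \<alpha> H) = const c * (\<Prod>H\<in>B. defining_form H)" by auto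
    obtain d where d: "d \<noteq> 0" "\<alpha> H = const d * defining_form H"
      using form_unique[OF _ _ assms(3) defining_form] A(2) insert.prems by blast
    have const_mult: "const (x * y) = (const x * const y :: 'n cpoly)" for x y unfolding const_def by (simp add: mult_single)
    then have "(\<Prod>H\<in>insert H B. \<alpha> H) = const (d * c) * (\<Prod>H\<in>insert H B. defining_form H)"
      using insert.hyps c d by (simp add: const_mult mult_ac)
    then show ?case using c d by (intro exI[of _ "d * c"]) simp
  qed
  then show ?thesis unfolding defining_poly_def by blast
qed

end

theory Submission
  imports Defs
begin

text \<open>
  The Jacobian scheme determines the order of vanishing of the Jacobian ideal at every point
  \<open>p \<noteq> 0\<close>, and this order is \<open>m(p) - 1\<close>, where \<open>m(p)\<close> is the number of hyperplanes through
  \<open>p\<close> (and it is \<open>0\<close> if \<open>m(p) = 0\<close>, by Euler's formula). Hence for every rank two flat \<open>X\<close> of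
  either arrangement the number \<open>m\<^sub>X\<close> of hyperplanes containing \<open>X\<close> is the same in both.
  If \<open>H \<in> A\<^sub>1\<close> but \<open>H \<notin> A\<^sub>2\<close>, then the sets of hyperplanes of \<open>A\<^sub>2\<close> through the various flats
  \<open>X \<subset> H\<close> of \<open>A\<^sub>1\<close> are disjoint, so that \<open>|A\<^sub>2| \<ge> \<Sum> m\<^sub>X\<close>, whereas \<open>|A\<^sub>1| = 1 + \<Sum> (m\<^sub>X - 1)\<close>;
  since \<open>A\<^sub>1\<close> is essential and \<open>\<ell> \<ge> 3\<close>, there are at least two such flats and
  \<open>|A\<^sub>1| < |A\<^sub>2|\<close>. By symmetry neither arrangement can contain a hyperplane missing from the other.
\<close>


section \<open>Restricting polynomials to lines\<close>

text \<open>Every operation used below is additive in the polynomial, so identities need checking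
  only on single terms.\<close>

lemma cpoly_induct [case_names single add]:
  fixes q :: "'n cpoly"
  assumes "\<And>m c. P (Poly_Mapping.single m c)" and "\<And>p q. P p \<Longrightarrow> P q \<Longrightarrow> P (p + q)"
  shows "P q"
proof (induction q rule: update_induct)
  case const
  show ?case using assms(1)[of 0 0] by simp
next
  case (update f a b)
  have "Poly_Mapping.update a b f = f + Poly_Mapping.single a b"
    using update(1) by (intro poly_mapping_eqI)
      (auto simp: lookup_update lookup_add lookup_single when_def in_keys_iff)
  then show ?case using assms update by simp
qed

section \<open>Leibniz rule for formal partial derivatives\<close>

lemma partial_deriv_0 [simp]: "partial_deriv i 0 = 0"
  by (simp add: partial_deriv_def)

lemma partial_deriv_single:
  "partial_deriv i (Poly_Mapping.single m c) =
     Poly_Mapping.single (m - Poly_Mapping.single i 1) (of_nat (Poly_Mapping.lookup m i) * c)"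
  by (simp add: partial_deriv_def)

lemma partial_deriv_add: "partial_deriv i (p + q) = partial_deriv i p + partial_deriv i q"
  unfolding partial_deriv_def
  by (rule setsum_keys_plus_distrib) (simp_all add: algebra_simps single_add)

lemma partial_deriv_mult:
  "partial_deriv i (p * q) = partial_deriv i p * q + p * partial_deriv i q"
proof (induction p rule: cpoly_induct)
  case (single m c)
  show ?case
  proof (induction q rule: cpoly_induct)
    case (single n d)
    \<comment> \<open>Truncated subtraction commutes with adding \<open>b\<close> only if
      \<open>i\<close> occurs in \<open>a\<close>; otherwise the coefficient is zero and both sides
      vanish.\<close>
    have shift: "Poly_Mapping.single (a - Poly_Mapping.single i 1 + b) (of_nat (Poly_Mapping.lookup a i) * e) =
        Poly_Mapping.single (a + b - Poly_Mapping.single i 1) (of_nat (Poly_Mapping.lookup a i) * e)"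
      for a b :: "'a \<Rightarrow>\<^sub>0 nat" and e :: complex
    proof (cases "Poly_Mapping.lookup a i = 0")
      case False
      have "a - Poly_Mapping.single i 1 + b = a + b - Poly_Mapping.single i 1"
        using False by (intro poly_mapping_eqI) (auto simp: lookup_add lookup_minus lookup_single when_def)
      then show ?thesis by simp
    qed simp
    have "partial_deriv i (Poly_Mapping.single m c * Poly_Mapping.single n d) =
        Poly_Mapping.single (m + n - Poly_Mapping.single i 1) (of_nat (Poly_Mapping.lookup m i) * (c * d)) +
        Poly_Mapping.single (n + m - Poly_Mapping.single i 1) (of_nat (Poly_Mapping.lookup n i) * (d * c))"
      unfolding add.commute[of n m]
      by (simp add: mult_single partial_deriv_single lookup_add algebra_simps flip: single_add)
    also have "\<dots> = partial_deriv i (Poly_Mapping.single m c) * Poly_Mapping.single n d +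
        Poly_Mapping.single m c * partial_deriv i (Poly_Mapping.single n d)"
      unfolding shift[symmetric]
      by (simp only: mult_single partial_deriv_single mult.assoc mult.left_commute[of c] mult.commute[of d c] add.commute[of m])
    finally show ?case .
  qed (simp add: partial_deriv_add distrib_left add_ac)
qed (simp add: partial_deriv_add distrib_right add_ac)

lemma partial_deriv_1 [simp]: "partial_deriv i 1 = 0"
  using partial_deriv_single[of i 0 1] by simp

lemma partial_deriv_prod:
  "finite B \<Longrightarrow> partial_deriv i (prod f B) = (\<Sum>H\<in>B. partial_deriv i (f H) * prod f (B - {H}))"
proof (induction B rule: finite_induct)
  case (insert K B)
  have "(\<Sum>H\<in>B. partial_deriv i (f H) * prod f (insert K B - {H})) =
      f K * (\<Sum>H\<in>B. partial_deriv i (f H) * prod f (B - {H}))"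
    unfolding sum_distrib_left
  proof (rule sum.cong[OF refl])
    fix H assume "H \<in> B"
    then have "insert K B - {H} = insert K (B - {H})" "K \<notin> B - {H}" using insert.hyps by auto
    then show "partial_deriv i (f H) * prod f (insert K B - {H}) =
        f K * (partial_deriv i (f H) * prod f (B - {H}))"
      using insert.hyps by (simp add: mult_ac)
  qed
  then show ?case using insert by (simp add: partial_deriv_mult)
qed simp

text \<open>A formal polynomial in the parameter t of the line \<open>p + t *s v\<close>, not a
  function: vanishing to order k at \<open>p\<close> becomes divisibility by
  \<open>[:0, 1:] ^ k\<close>, and \<open>order 0\<close> applies.\<close>

definition line_restrict :: "complex ^ 'n \<Rightarrow> complex ^ 'n \<Rightarrow> 'n::finite cpoly \<Rightarrow> complex poly" where
  "line_restrict p v q = (\<Sum>m\<in>Poly_Mapping.keys q.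
     smult (Poly_Mapping.lookup q m) (\<Prod>i\<in>UNIV. [:p $ i, v $ i:] ^ Poly_Mapping.lookup m i))"

lemma poly_line_restrict: "poly (line_restrict p v q) t = poly_eval q (p + t *s v)"
  by (simp add: line_restrict_def poly_eval_def poly_sum poly_prod)

lemma line_restrict_single:
  "line_restrict p v (Poly_Mapping.single m c) =
     smult c (\<Prod>i\<in>UNIV. [:p $ i, v $ i:] ^ Poly_Mapping.lookup m i)"
  by (simp add: line_restrict_def)

lemma line_restrict_add: "line_restrict p v (q + r) = line_restrict p v q + line_restrict p v r"
  unfolding line_restrict_def
  by (rule setsum_keys_plus_distrib) (simp_all add: smult_add_left)

lemma line_restrict_0 [simp]: "line_restrict p v 0 = 0"
  by (simp add: line_restrict_def)

lemma line_restrict_1 [simp]: "line_restrict p v 1 = 1"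
  by (simp add: line_restrict_def)

lemma line_restrict_sum: "line_restrict p v (sum f B) = (\<Sum>b\<in>B. line_restrict p v (f b))"
  by (induction B rule: infinite_finite_induct) (simp_all add: line_restrict_add)

lemma line_restrict_mult: "line_restrict p v (q * r) = line_restrict p v q * line_restrict p v r"
proof (induction q rule: cpoly_induct)
  case (single m c)
  show ?case
  proof (induction r rule: cpoly_induct)
    case (single n d)
    show ?case
      by (simp add: mult_single line_restrict_single lookup_add power_add prod.distrib mult.commute)
  qed (simp add: line_restrict_add distrib_left)
qed (simp add: line_restrict_add distrib_right)

lemma line_restrict_prod: "line_restrict p v (prod f B) = (\<Prod>b\<in>B. line_restrict p v (f b))"
  by (induction B rule: infinite_finite_induct) (simp_all add: line_restrict_mult)

lemma line_restrict_linear_form: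
  assumes "homogeneous 1 \<alpha>"
  shows "line_restrict p v \<alpha> = [:poly_eval \<alpha> p, poly_eval \<alpha> v:]"
proof -
  have "poly (line_restrict p v \<alpha>) t = poly [:poly_eval \<alpha> p, poly_eval \<alpha> v:] t" for t
    unfolding poly_line_restrict poly_eval_linear_form[OF assms]
    by (simp add: sum_distrib_left sum.distrib algebra_simps)
  then show ?thesis by (simp add: poly_eq_poly_eq_iff[symmetric] fun_eq_iff)
qed

text \<open>The chain rule along the line. It transfers divisibility by a power of t from all
  partial derivatives of a polynomial to the derivative of its restriction.\<close>

lemma pderiv_line_restrict:
  "pderiv (line_restrict p v q) = (\<Sum>i\<in>UNIV. smult (v $ i) (line_restrict p v (partial_deriv i q)))"
proof (induction q rule: cpoly_induct)
  case (single m c)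
  let ?l = "\<lambda>i. [:p $ i, v $ i:]"
  have "smult c (prod (\<lambda>j. ?l j ^ Poly_Mapping.lookup m j) (UNIV - {i}) * pderiv (?l i ^ Poly_Mapping.lookup m i)) =
      smult (v $ i) (line_restrict p v (partial_deriv i (Poly_Mapping.single m c)))" for i
  proof -
    have "(\<Prod>j\<in>UNIV. ?l j ^ Poly_Mapping.lookup (m - Poly_Mapping.single i 1) j) =
        ?l i ^ (Poly_Mapping.lookup m i - 1) * (\<Prod>j\<in>UNIV - {i}. ?l j ^ Poly_Mapping.lookup m j)"
      by (subst prod.remove[of _ i]) (auto simp: lookup_minus lookup_single when_def intro!: prod.cong)
    then show ?thesis
      by (simp add: partial_deriv_single line_restrict_single pderiv_power pderiv_pCons mult_ac)
  qed
  then have "(\<Sum>i\<in>UNIV. smult c (prod (\<lambda>j. ?l j ^ Poly_Mapping.lookup m j) (UNIV - {i}) *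
        pderiv (?l i ^ Poly_Mapping.lookup m i))) =
      (\<Sum>i\<in>UNIV. smult (v $ i) (line_restrict p v (partial_deriv i (Poly_Mapping.single m c))))"
    by (rule sum.cong[OF refl])
  moreover have "(\<Sum>i\<in>UNIV. smult c (h i)) = smult c (\<Sum>i\<in>UNIV. h i)" for h :: "'a \<Rightarrow> complex poly"
    using sum_distrib_left[of "[:c:]" h UNIV] by simp
  ultimately show ?case
    by (simp add: line_restrict_single pderiv_smult pderiv_prod)
qed (simp add: line_restrict_add partial_deriv_add pderiv_add smult_add_right sum.distrib)


section \<open>The order of vanishing of the Jacobian ideal at a point\<close>

text \<open>A linear form vanishing at \<open>p\<close> restricts to a constant multiple of t,
  whatever the direction \<open>v\<close>.\<close>

lemma monom_dvd_line_restrict_prod: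
  assumes "finite B" and "\<And>H. H \<in> B \<Longrightarrow> homogeneous 1 (\<alpha> H)"
  shows "[:0, 1:] ^ card {H \<in> B. poly_eval (\<alpha> H) p = 0} dvd line_restrict p v (prod \<alpha> B)"
proof -
  let ?B = "{H \<in> B. poly_eval (\<alpha> H) p = 0}"
  have "[:0, 1:] ^ card ?B = (\<Prod>H\<in>?B. [:0, 1::complex:])" by simp
  also have "\<dots> dvd (\<Prod>H\<in>?B. line_restrict p v (\<alpha> H))"
    using assms(2) by (intro prod_dvd_prod) (auto simp: line_restrict_linear_form dvd_iff_poly_eq_0)
  also have "\<dots> dvd (\<Prod>H\<in>B. line_restrict p v (\<alpha> H))"
    by (rule prod_dvd_prod_subset) (use assms(1) in auto)
  finally show ?thesis by (simp add: line_restrict_prod)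
qed

text \<open>Each Leibniz summand omits one factor from the product, hence loses at most one of the
  forms vanishing at \<open>p\<close>.\<close>

lemma monom_dvd_line_restrict_partial_deriv_prod:
  assumes "finite B" and "\<And>H. H \<in> B \<Longrightarrow> homogeneous 1 (\<alpha> H)"
  shows "[:0, 1:] ^ (card {H \<in> B. poly_eval (\<alpha> H) p = 0} - 1) dvd
    line_restrict p v (partial_deriv i (prod \<alpha> B))"
  unfolding partial_deriv_prod[OF assms(1)] line_restrict_sum line_restrict_mult
proof (intro dvd_sum dvd_mult)
  fix K assume "K \<in> B"
  let ?Z = "\<lambda>B. {H \<in> B. poly_eval (\<alpha> H) p = 0}"
  have "?Z B - {K} = ?Z (B - {K})" by auto
  then have "card (?Z B) - 1 \<le> card (?Z (B - {K}))"
    by (metis (no_types, lifting) card_Diff_singleton_if diff_le_self order_refl)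
  then show "[:0, 1:] ^ (card (?Z B) - 1) dvd line_restrict p v (prod \<alpha> (B - {K}))"
    using monom_dvd_line_restrict_prod[of "B - {K}" \<alpha> p v] assms by (meson DiffD1 dvd_trans finite_Diff le_imp_power_dvd)
qed

text \<open>Over an infinite field a vector space is not a finite union of proper subspaces. The
  induction moves a point \<open>v\<close> that is good for \<open>B\<close> but lies in
  \<open>H\<close> along a direction \<open>w\<close> outside \<open>H\<close>.\<close>

lemma subspace_avoid:
  fixes X :: "(complex ^ 'n::finite) set"
  assumes "finite B" "vec.subspace X" "\<And>H. H \<in> B \<Longrightarrow> vec.subspace H \<and> \<not> X \<subseteq> H"
  shows "\<exists>v\<in>X. \<forall>H\<in>B. v \<notin> H"
  using assms(1,3)
proof (induction B rule: finite_induct)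
  case empty
  show ?case using vec.subspace_0[OF assms(2)] by auto
next
  case (insert H B)
  then obtain v where v: "v \<in> X" "\<forall>K\<in>B. v \<notin> K" by auto
  show ?case
  proof (cases "v \<in> H")
    case True
    obtain w where w: "w \<in> X" "w \<notin> H" using insert.prems by blast
    \<comment> \<open>The line meets each \<open>K\<close> at most once: two common points would put
      \<open>w\<close>, and then \<open>v\<close>, into \<open>K\<close>.\<close>
    have "t = u" if "K \<in> B" "v + t *s w \<in> K" "v + u *s w \<in> K" for K t u
    proof (rule ccontr)
      assume "t \<noteq> u"
      have K: "vec.subspace K" using insert.prems that by blast
      have "(t - u) *s w = (v + t *s w) - (v + u *s w)" by (simp add: vector_sub_rdistrib)
      also have "\<dots> \<in> K" using that K vec.subspace_diff by blast
      finally have "inverse (t - u) *s ((t - u) *s w) \<in> K" using K vec.subspace_scale by blast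
      moreover have "inverse (t - u) *s ((t - u) *s w) = w"
        unfolding vector_smult_assoc using \<open>t \<noteq> u\<close> by simp
      ultimately have "w \<in> K" by simp
      then have "v + t *s w - t *s w \<in> K" using that K vec.subspace_diff vec.subspace_scale by blast
      then show False using v that by simp
    qed
    then have "finite {t. v + t *s w \<in> K}" if "K \<in> B" for K
      using that by (metis (mono_tags, lifting) finite.emptyI finite_insert finite_subset insertCI mem_Collect_eq subsetI)
    \<comment> \<open>The value 0 is excluded as well, because it gives back \<open>v\<close>, which
      lies in \<open>H\<close>.\<close>
    then have "finite (insert 0 (\<Union>K\<in>B. {t. v + t *s w \<in> K}))" using insert.hyps by simp
    then obtain t where t: "t \<notin> insert 0 (\<Union>K\<in>B. {t. v + t *s w \<in> K})"
      using ex_new_if_finite[OF infinite_UNIV_char_0[where 'a = complex]] by blast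
    have "v + t *s w \<notin> H"
    proof
      assume "v + t *s w \<in> H"
      moreover have H: "vec.subspace H" using insert.prems by blast
      ultimately have "v + t *s w - v \<in> H" using True vec.subspace_diff by blast
      then have "inverse t *s (t *s w) \<in> H" using H vec.subspace_scale by fastforce
      then show False using w t by simp
    qed
    moreover have "v + t *s w \<in> X" using v w assms(2) by (simp add: vec.subspace_add vec.subspace_scale)
    ultimately show ?thesis using t by (intro bexI[of _ "v + t *s w"]) auto
  qed (use v in auto)
qed

lemma subspace_linear_form:
  assumes "homogeneous 1 \<alpha>"
  shows "vec.subspace {v. poly_eval \<alpha> v = 0}"
  unfolding vec.subspace_def poly_eval_linear_form[OF assms]
  by (auto simp: distrib_left sum.distrib mult.left_commute sum_distrib_left[symmetric])

text \<open>The upper bound on the order of the Jacobian ideal at \<open>p\<close>. If it failed,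
  the chain rule would make the derivative of the restricted product too divisible in every
  direction. The direction \<open>p\<close> refutes this when no form vanishes at \<open>p\<close>,
  and a direction off all hyperplanes refutes it otherwise.\<close>

lemma exists_partial_deriv_prod_not_monom_dvd:
  assumes "finite B" "B \<noteq> {}" and hom: "\<And>H. H \<in> B \<Longrightarrow> homogeneous 1 (\<alpha> H)"
    and nz: "\<And>H. H \<in> B \<Longrightarrow> \<exists>v. poly_eval (\<alpha> H) v \<noteq> 0"
  shows "\<exists>i v. \<not> [:0, 1:] ^ max (card {H \<in> B. poly_eval (\<alpha> H) p = 0}) 1 dvd
    line_restrict p v (partial_deriv i (prod \<alpha> B))"
proof (rule ccontr)
  let ?Z = "{H \<in> B. poly_eval (\<alpha> H) p = 0}"
  let ?N = "max (card ?Z) 1"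
  define f where "f v = line_restrict p v (prod \<alpha> B)" for v
  have f: "f v = (\<Prod>H\<in>B. [:poly_eval (\<alpha> H) p, poly_eval (\<alpha> H) v:])" for v
    unfolding f_def line_restrict_prod using hom by (simp add: line_restrict_linear_form)
  assume "\<nexists>i v. \<not> [:0, 1:] ^ ?N dvd line_restrict p v (partial_deriv i (prod \<alpha> B))"
  then have dvd: "[:0, 1:] ^ ?N dvd pderiv (f v)" for v
    unfolding f_def pderiv_line_restrict by (intro dvd_sum dvd_smult) auto
  show False
  proof (cases "?Z = {}")
    case True
    \<comment> \<open>Euler's formula in disguise: in the direction \<open>p\<close> each form
      restricts to its value at \<open>p\<close> times 1 + t.\<close>
    have "f p = (\<Prod>H\<in>B. smult (poly_eval (\<alpha> H) p) [:1, 1:])" by (simp add: f)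
    also have "\<dots> = smult (\<Prod>H\<in>B. poly_eval (\<alpha> H) p) ([:1, 1:] ^ card B)"
      by (simp only: prod_smult prod_constant)
    finally have "poly (pderiv (f p)) 0 = (\<Prod>H\<in>B. poly_eval (\<alpha> H) p) * of_nat (card B)"
      by (simp add: pderiv_smult pderiv_power pderiv_pCons)
    moreover have "poly (pderiv (f p)) 0 = 0"
      using dvd[of p] unfolding True by (simp add: dvd_iff_poly_eq_0)
    ultimately show False using True assms(1,2) by auto
  next
    case False
    let ?H = "\<lambda>H. {v. poly_eval (\<alpha> H) v = 0}"
    have "\<exists>v\<in>UNIV. \<forall>K\<in>?H ` B. v \<notin> K"
      by (rule subspace_avoid) (use assms(1) hom nz in \<open>auto intro!: subspace_linear_form simp: subset_iff\<close>)
    then obtain v where v: "\<And>H. H \<in> B \<Longrightarrow> poly_eval (\<alpha> H) v \<noteq> 0" by auto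
    \<comment> \<open>The cofactor of the power of t in \<open>f v\<close>; it is nonzero at 0 by
      the choice of \<open>v\<close>.\<close>
    define r where "r = (\<Prod>H\<in>?Z. [:poly_eval (\<alpha> H) v:]) *
      (\<Prod>H\<in>B - ?Z. [:poly_eval (\<alpha> H) p, poly_eval (\<alpha> H) v:])"
    have "f v = (\<Prod>H\<in>?Z. [:0, 1:] * [:poly_eval (\<alpha> H) v:]) *
        (\<Prod>H\<in>B - ?Z. [:poly_eval (\<alpha> H) p, poly_eval (\<alpha> H) v:])"
      unfolding f using assms(1)
      by (subst prod.subset_diff[of ?Z]) (auto simp: mult.commute intro!: arg_cong2[of _ _ _ _ "(*)"] prod.cong)
    then have fr: "f v = [:0, 1:] ^ card ?Z * r"
      by (simp only: prod.distrib r_def mult.assoc prod_constant)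
    have r: "poly r 0 \<noteq> 0" using assms(1) v by (auto simp: r_def poly_prod)
    then have "f v \<noteq> 0" unfolding fr by auto
    moreover have pos: "card ?Z > 0" using False assms(1) by (simp add: card_gt_0_iff)
    then have f0: "poly (f v) 0 = 0" unfolding fr by simp
    ultimately have "order 0 (f v) = Suc (order 0 (pderiv (f v)))" by (rule order_pderiv)
    moreover have "order 0 (f v) = card ?Z"
      using order_power_n_n[of "0::complex"] r \<open>f v \<noteq> 0\<close> unfolding fr
      by (subst order_mult) (auto simp: order_0I)
    \<comment> \<open>A zero derivative would make \<open>f v\<close> constant, hence zero, since it
      vanishes at 0.\<close>
    moreover have "pderiv (f v) \<noteq> 0"
      using \<open>f v \<noteq> 0\<close> f0 pderiv_iszero[of "f v"] by fastforce
    then have "?N \<le> order 0 (pderiv (f v))" using dvd[of v] order_divides[of 0 ?N "pderiv (f v)"] by simp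
    ultimately show False using pos by simp
  qed
qed


section \<open>From the ideal sheaf back to the ideal\<close>

lemma homogeneous_0 [simp]: "homogeneous d 0"
  by (simp add: homogeneous_def)

lemma homogeneous_1: "homogeneous 0 1"
  by (simp add: homogeneous_def mdeg_def)

lemma mdeg_add: "mdeg (m + n) = mdeg m + mdeg n"
  by (simp add: mdeg_def lookup_add sum.distrib)

lemma mdeg_single [simp]: "mdeg (Poly_Mapping.single i e) = e"
  by (simp add: mdeg_def lookup_single when_def)

lemma homogeneous_mult:
  assumes "homogeneous d p" "homogeneous e q"
  shows "homogeneous (d + e) (p * q)"
  using assms keys_mult[of p q] unfolding homogeneous_def by (fastforce simp: mdeg_add)

lemma homogeneous_add:
  assumes "homogeneous d p" "homogeneous d q"
  shows "homogeneous d (p + q)"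
  using assms Poly_Mapping.keys_add[of p q] unfolding homogeneous_def by blast

lemma homogeneous_sum: "(\<And>x. x \<in> B \<Longrightarrow> homogeneous d (f x)) \<Longrightarrow> homogeneous d (sum f B)"
  by (induction B rule: infinite_finite_induct) (auto intro: homogeneous_add)

lemma homogeneous_prod_linear_forms:
  "(\<And>H. H \<in> B \<Longrightarrow> homogeneous 1 (f H)) \<Longrightarrow> finite B \<Longrightarrow> homogeneous (card B) (prod f B)"
proof (induction B rule: infinite_finite_induct)
  case (insert K B)
  then show ?case using homogeneous_mult[of 1 "f K" "card B" "prod f B"] by simp
qed (simp_all add: homogeneous_1)

lemma homogeneous_partial_deriv:
  assumes "homogeneous d p"
  shows "homogeneous (d - 1) (partial_deriv i p)"
  unfolding partial_deriv_def
proof (rule homogeneous_sum)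
  fix m assume m: "m \<in> Poly_Mapping.keys p"
  show "homogeneous (d - 1) (Poly_Mapping.single (m - Poly_Mapping.single i 1)
      (of_nat (Poly_Mapping.lookup m i) * Poly_Mapping.lookup p m))"
  proof (cases "Poly_Mapping.lookup m i = 0")
    case False
    then have "m = (m - Poly_Mapping.single i 1) + Poly_Mapping.single i 1"
      by (intro poly_mapping_eqI) (auto simp: lookup_add lookup_minus lookup_single when_def)
    then have "mdeg m = mdeg (m - Poly_Mapping.single i 1) + 1" by (metis mdeg_add mdeg_single)
    then show ?thesis using assms m by (auto simp: homogeneous_def)
  qed simp
qed

section \<open>Lines through the origin and the homogeneous primes of points\<close>

lemma line_restrict_origin:
  "line_restrict 0 p q = (\<Sum>m\<in>Poly_Mapping.keys q.
     monom (Poly_Mapping.lookup q m * (\<Prod>i\<in>UNIV. (p $ i) ^ Poly_Mapping.lookup m i)) (mdeg m))"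
proof -
  have "(\<Prod>i\<in>UNIV. [:0, p $ i:] ^ Poly_Mapping.lookup m i) =
      monom (\<Prod>i\<in>UNIV. (p $ i) ^ Poly_Mapping.lookup m i) (mdeg m)" for m
  proof -
    have "(\<Prod>i\<in>B. [:0, p $ i:] ^ Poly_Mapping.lookup m i) =
        monom (\<Prod>i\<in>B. (p $ i) ^ Poly_Mapping.lookup m i) (\<Sum>i\<in>B. Poly_Mapping.lookup m i)" for B
    proof (induction B rule: infinite_finite_induct)
      case (insert i B)
      have "[:0, p $ i:] = monom (p $ i) 1" by (simp add: monom_altdef)
      then show ?case using insert by (simp add: monom_power mult_monom)
    qed simp_all
    then show ?thesis by (simp add: mdeg_def)
  qed
  then show ?thesis by (simp add: line_restrict_def smult_monom)
qed

lemma line_restrict_origin_homogeneous: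
  assumes "homogeneous d q"
  shows "line_restrict 0 p q = monom (poly_eval q p) d"
proof -
  have "line_restrict 0 p q = (\<Sum>m\<in>Poly_Mapping.keys q.
     monom (Poly_Mapping.lookup q m * (\<Prod>i\<in>UNIV. (p $ i) ^ Poly_Mapping.lookup m i)) d)"
    unfolding line_restrict_origin using assms by (intro sum.cong) (auto simp: homogeneous_def)
  then show ?thesis by (simp add: poly_eval_def monom_sum)
qed

text \<open>On a line through the origin a monomial of degree d becomes a multiple of t^d, so the
  grading of S turns into the grading by powers of t.\<close>

lemma line_restrict_origin_hom_component:
  "line_restrict 0 p (hom_component d q) = monom (coeff (line_restrict 0 p q) d) d"
proof -
  let ?c = "\<lambda>m. Poly_Mapping.lookup q m * (\<Prod>i\<in>UNIV. (p $ i) ^ Poly_Mapping.lookup m i)"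
  have "line_restrict 0 p (hom_component d q) = (\<Sum>m\<in>{m \<in> Poly_Mapping.keys q. mdeg m = d}. monom (?c m) d)"
    unfolding hom_component_def line_restrict_sum
    by (intro sum.cong refl) (auto simp: line_restrict_origin)
  also have "\<dots> = monom (\<Sum>m\<in>{m \<in> Poly_Mapping.keys q. mdeg m = d}. ?c m) d"
    by (simp add: monom_sum)
  also have "(\<Sum>m\<in>{m \<in> Poly_Mapping.keys q. mdeg m = d}. ?c m) = coeff (line_restrict 0 p q) d"
    unfolding line_restrict_origin coeff_sum by (simp add: sum.inter_filter)
  finally show ?thesis .
qed

text \<open>For \<open>p\<close> nonzero this is the homogeneous prime of the point [p], given as
  the kernel of the ring homomorphism from S to C[t] that sends z_i to p_i t.\<close>

definition line_ideal :: "complex ^ 'n \<Rightarrow> 'n::finite cpoly set" where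
  "line_ideal p = {q. line_restrict 0 p q = 0}"

lemma homogeneous_in_line_ideal_iff:
  "homogeneous d q \<Longrightarrow> q \<in> line_ideal p \<longleftrightarrow> poly_eval q p = 0"
  by (simp add: line_ideal_def line_restrict_origin_homogeneous)

abbreviation var :: "'n \<Rightarrow> 'n::finite cpoly" where
  "var i \<equiv> Poly_Mapping.single (Poly_Mapping.single i 1) 1"

lemma var_power: "Poly_Mapping.single (Poly_Mapping.single i e) 1 = var i ^ e"
proof (induction e)
  case (Suc e)
  have "Poly_Mapping.single i (Suc e) = Poly_Mapping.single i 1 + Poly_Mapping.single i e"
    by (simp flip: single_add)
  then have "Poly_Mapping.single (Poly_Mapping.single i (Suc e)) 1 =
      var i * Poly_Mapping.single (Poly_Mapping.single i e) 1"
    by (simp add: mult_single)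
  then show ?case using Suc by simp
qed simp

lemma var_notin_line_ideal: "p $ i \<noteq> 0 \<Longrightarrow> var i \<notin> line_ideal p"
proof -
  assume "p $ i \<noteq> 0"
  have "homogeneous 1 (var i)" by (simp add: homogeneous_def)
  moreover have "poly_eval (var i) p = p $ i"
  proof -
    have "Poly_Mapping.single i (1::nat) = Poly_Mapping.single j 1 \<longleftrightarrow> j = i" for j
      by (metis lookup_single_eq lookup_single_not_eq one_neq_zero)
    then have "Poly_Mapping.lookup (var i) (Poly_Mapping.single j 1) * p $ j = (if j = i then p $ j else 0)" for j
      by (simp only: lookup_single) (simp add: when_def)
    then show ?thesis unfolding poly_eval_linear_form[OF calculation] by simp
  qed
  ultimately show ?thesis using \<open>p $ i \<noteq> 0\<close> by (simp only: homogeneous_in_line_ideal_iff not_False_eq_True)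
qed

text \<open>The ideal is prime because C[t] is a domain, and a variable with nonzero coordinate at
  \<open>p\<close> keeps it from containing the irrelevant ideal.\<close>

lemma line_ideal_in_proj_points:
  assumes "p \<noteq> 0"
  shows "line_ideal p \<in> proj_points {0}"
proof -
  have ideal: "ring_ideal (line_ideal p)"
    unfolding ring_ideal_iff line_ideal_def by (simp add: line_restrict_add line_restrict_mult)
  obtain i where i: "p $ i \<noteq> 0" using assms by (auto simp: vec_eq_iff)
  have "{m \<in> Poly_Mapping.keys (var i). mdeg m = 0} = {}" by auto
  then have "var i \<in> irrelevant_ideal"
    by (simp only: irrelevant_ideal_def hom_component_def sum.empty mem_Collect_eq)
  moreover have "1 \<notin> line_ideal p" by (simp add: line_ideal_def)
  then have "line_ideal p \<noteq> UNIV" by blast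
  with ideal have "prime_ideal (line_ideal p)"
    unfolding prime_ideal_def by (simp add: line_ideal_def line_restrict_mult)
  moreover have "homogeneous_ideal (line_ideal p)"
    using ideal unfolding homogeneous_ideal_def
    by (simp add: line_ideal_def line_restrict_origin_hom_component)
  ultimately show ?thesis
    using ideal var_notin_line_ideal[of p i, OF i] by (auto simp: proj_points_def ring_ideal_iff)
qed

text \<open>The ideal \<open>(z\<^sub>i)\<close>, in a form that makes its homogeneity evident.\<close>

definition var_ideal :: "'n \<Rightarrow> 'n::finite cpoly set" where
  "var_ideal i = {q. \<forall>m\<in>Poly_Mapping.keys q. Poly_Mapping.lookup m i \<noteq> 0}"

lemma homogeneous_ideal_var_ideal: "homogeneous_ideal (var_ideal i)"
  unfolding homogeneous_ideal_def ring_ideal_iff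
proof (intro conjI ballI allI)
  fix p q :: "'a cpoly"
  assume p: "p \<in> var_ideal i"
  show "q * p \<in> var_ideal i" using p keys_mult[of q p] by (fastforce simp: var_ideal_def lookup_add)
  show "p + q \<in> var_ideal i" if "q \<in> var_ideal i"
    using p that Poly_Mapping.keys_add[of p q] by (auto simp: var_ideal_def)
  fix d
  have "Poly_Mapping.keys (hom_component d p) \<subseteq> Poly_Mapping.keys p"
  proof
    fix m assume "m \<in> Poly_Mapping.keys (hom_component d p)"
    then have "Poly_Mapping.lookup (hom_component d p) m \<noteq> 0" by (simp add: in_keys_iff)
    then show "m \<in> Poly_Mapping.keys p"
      unfolding hom_component_def lookup_sum
      by (rule contrapos_np) (auto intro!: sum.neutral simp: lookup_single when_def)
  qed
  then show "hom_component d p \<in> var_ideal i" using p by (auto simp: var_ideal_def)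
qed (simp add: var_ideal_def)

text \<open>Each term of a member of \<open>var_ideal i\<close> is a multiple of
  \<open>var i\<close>. Consequently the open set cut out by \<open>var_ideal i\<close> is where
  \<open>var i\<close> avoids the prime.\<close>

lemma var_ideal_subset:
  assumes "ring_ideal P" "var i \<in> P"
  shows "var_ideal i \<subseteq> P"
proof
  fix q assume q: "q \<in> var_ideal i"
  have "Poly_Mapping.single m c \<in> P" if "Poly_Mapping.lookup m i \<noteq> 0" for m and c :: complex
  proof -
    have "m = (m - Poly_Mapping.single i 1) + Poly_Mapping.single i 1"
      using that by (intro poly_mapping_eqI) (auto simp: lookup_add lookup_minus lookup_single when_def)
    then have "Poly_Mapping.single m c = Poly_Mapping.single (m - Poly_Mapping.single i 1) c * var i"
      by (metis mult.right_neutral mult_single)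
    then show ?thesis using assms unfolding ring_ideal_iff by metis
  qed
  moreover have "sum f B \<in> P" if "\<And>b. b \<in> B \<Longrightarrow> f b \<in> P" for f :: "_ \<Rightarrow> 'a cpoly" and B :: "('a \<Rightarrow>\<^sub>0 nat) set"
    using that assms(1) unfolding ring_ideal_iff
    by (induction B rule: infinite_finite_induct) auto
  moreover have "q = (\<Sum>m\<in>Poly_Mapping.keys q. Poly_Mapping.single m (Poly_Mapping.lookup q m))"
    by (rule poly_mapping_eqI) (auto simp: lookup_sum lookup_single when_def in_keys_iff)
  ultimately show "q \<in> P"
    using q unfolding var_ideal_def mem_Collect_eq by (metis (no_types, lifting))
qed

section \<open>Vanishing of fractions in the local rings\<close>

lemma one_notin_prime_ideal:
  assumes "prime_ideal P"
  shows "1 \<notin> P"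
proof
  assume "1 \<in> P"
  then have "r * 1 \<in> P" for r using assms unfolding prime_ideal_def ring_ideal_iff by blast
  then show False using assms unfolding prime_ideal_def by auto
qed

text \<open>The numerator is killed by \<open>h\<close>, which is a unit in the localization. On
  representatives, the multiplier \<open>k\<close> of one equivalence becomes
  \<open>h * k * f\<close> or \<open>h * k\<close> for the other.\<close>

lemma proj_frac_eq_0:
  assumes J: "ring_ideal J" and P: "prime_ideal P"
    and f: "homogeneous d f" "f \<notin> P" and h: "homogeneous e h" "h \<notin> P" and "h * a \<in> J"
  shows "proj_frac J P a f = proj_frac J P 0 1"
proof -
  have notP: "x * y \<notin> P" if "x \<notin> P" "y \<notin> P" for x y using P that unfolding prime_ideal_def by blast
  have J': "x + y \<in> J" "r * x \<in> J" "x - y \<in> J" if "x \<in> J" "y \<in> J" for x y r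
    using J that unfolding ring_ideal_iff
    by (simp_all, metis diff_conv_add_uminus mult_minus1)
  have "(\<exists>e h. homogeneous e h \<and> h \<notin> P \<and> h * (a * g - b * f) \<in> J) \<longleftrightarrow>
      (\<exists>e h. homogeneous e h \<and> h \<notin> P \<and> h * (0 * g - b * 1) \<in> J)" for b g
  proof
    assume "\<exists>e h. homogeneous e h \<and> h \<notin> P \<and> h * (a * g - b * f) \<in> J"
    then obtain e' k where k: "homogeneous e' k" "k \<notin> P" "k * (a * g - b * f) \<in> J" by blast
    have "h * k * f * (0 * g - b * 1) = h * (k * (a * g - b * f)) - (k * g) * (h * a)"
      by (simp add: algebra_simps)
    then have "h * k * f * (0 * g - b * 1) \<in> J" using J' k(3) assms(7) by metis
    then show "\<exists>e h. homogeneous e h \<and> h \<notin> P \<and> h * (0 * g - b * 1) \<in> J"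
      using homogeneous_mult[OF homogeneous_mult[OF h(1) k(1)] f(1)] notP f h k by blast
  next
    assume "\<exists>e h. homogeneous e h \<and> h \<notin> P \<and> h * (0 * g - b * 1) \<in> J"
    then obtain e' k where k: "homogeneous e' k" "k \<notin> P" "k * (0 * g - b * 1) \<in> J" by blast
    have "h * k * (a * g - b * f) = (k * g) * (h * a) + (h * f) * (k * (0 * g - b * 1))"
      by (simp add: algebra_simps)
    then have "h * k * (a * g - b * f) \<in> J" using J' k(3) assms(7) by metis
    then show "\<exists>e h. homogeneous e h \<and> h \<notin> P \<and> h * (a * g - b * f) \<in> J"
      using homogeneous_mult[OF h(1) k(1)] notP h k by blast
  qed
  then show ?thesis unfolding proj_frac_def by simp
qed

text \<open>The section \<open>g/z\<^sub>i\<^sup>d\<close> over \<open>{z\<^sub>i \<noteq> 0}\<close> lies in the ideal sheaf of \<open>J\<close>; reading this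
  membership in the ideal sheaf of \<open>J'\<close> at the point \<open>[p]\<close> yields the multiplier \<open>h\<close>.\<close>

lemma Proj_quotient_eq_imp_locally_in:
  fixes p :: "complex ^ 'n::finite"
  assumes eq: "Proj_quotient J = Proj_quotient J'"
    and J: "ring_ideal J" and J': "J' = ideal_generated B" and B: "\<And>b. b \<in> B \<Longrightarrow> \<exists>d. homogeneous d b"
    and g: "g \<in> J" "homogeneous d g" and p: "p \<noteq> 0"
  shows "\<exists>h. poly_eval h p \<noteq> 0 \<and> h * g \<in> J'"
proof (cases "J' \<subseteq> line_ideal p")
  \<comment> \<open>Here [p] is not in the support of \<open>J'\<close>. A generator outside
    \<open>line_ideal p\<close> serves as \<open>h\<close>; its homogeneity turns nonmembership into
    a nonzero value at \<open>p\<close>.\<close>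
  case False
  note P = line_ideal_in_proj_points[OF p]
  have "\<not> B \<subseteq> line_ideal p"
    using False P ideal_generated_least(3) unfolding J' proj_points_def homogeneous_ideal_def by blast
  then obtain b where b: "b \<in> B" "b \<notin> line_ideal p" by blast
  have "ring_ideal J'" "b \<in> J'" using ideal_generated_least(1,2) b(1) unfolding J' by blast+
  then have "g * b \<in> J'" by (simp add: ring_ideal_iff)
  then show ?thesis using B[OF b(1)] b(2) homogeneous_in_line_ideal_iff by (metis mult.commute)
next
  case True
  let ?P = "line_ideal p"
  have J'i: "ring_ideal J'" unfolding J' by (rule ideal_generated_least)
  note P0 = line_ideal_in_proj_points[OF p]
  then have P: "?P \<in> proj_points J'" using True by (auto simp: proj_points_def)
  obtain i where i: "p $ i \<noteq> 0" using p by (auto simp: vec_eq_iff)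
  \<comment> \<open>The power of z_i has the degree of \<open>g\<close>, so that \<open>g/f\<close>
    has degree zero.\<close>
  define f where "f = (Poly_Mapping.single (Poly_Mapping.single i d) 1 :: 'n cpoly)"
  have f: "homogeneous d f" by (simp add: f_def homogeneous_def)
  define U where "U = {P \<in> proj_points {0}. \<not> var_ideal i \<subseteq> P}"
  have U: "proj_open {0} U"
    unfolding proj_open_def U_def using homogeneous_ideal_var_ideal by blast
  have fP: "f \<notin> P \<and> prime_ideal P" if "P \<in> U" for P
  proof -
    have P: "prime_ideal P" "ring_ideal P" "\<not> var_ideal i \<subseteq> P"
      using that unfolding U_def proj_points_def homogeneous_ideal_def by auto
    then have "var i \<notin> P" using var_ideal_subset by blast
    moreover have "1 \<notin> P" using P(1) by (rule one_notin_prime_ideal)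
    ultimately have "var i ^ k \<notin> P" for k
      using P(1) unfolding prime_ideal_def by (induction k) auto
    then show ?thesis using P(1) var_power[of i d] unfolding f_def by metis
  qed
  have "var i \<in> var_ideal i" by (simp add: var_ideal_def)
  then have PU: "?P \<in> U" using P0 i var_notin_line_ideal unfolding U_def by blast
  define s where "s = (\<lambda>P\<in>U. proj_frac {0} P g f)"
  have s: "s \<in> proj_sections {0} U"
    unfolding proj_sections_def
  proof (intro CollectI conjI ballI)
    fix P assume "P \<in> U"
    then show "\<exists>W. proj_open {0} W \<and> P \<in> W \<and> W \<subseteq> U \<and> (\<exists>d a f. homogeneous d a \<and> homogeneous d f \<and>
        (\<forall>P'\<in>W. f \<notin> P' \<and> s P' = proj_frac {0} P' a f))"
      using U g(2) f fP unfolding s_def by (intro exI[of _ U]) auto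
  qed (simp add: s_def)
  have self: "(g, f) \<in> proj_frac K P g f" if "P \<in> U" "ring_ideal K" for K P
  proof -
    have "1 * (g * f - g * f) \<in> K" using that(2) by (simp add: ring_ideal_iff)
    then show ?thesis
      using fP[OF that(1)] one_notin_prime_ideal[of P] f g(2) homogeneous_1 unfolding proj_frac_def by blast
  qed
  have zero: "ring_ideal {0 :: 'n cpoly}" by (simp add: ring_ideal_iff)
  \<comment> \<open>The stalk map is a union over all representatives of \<open>g/f\<close>, so each
    of them must be shown to have the zero class modulo \<open>J\<close>.\<close>
  have "proj_stalk_map J P (s P) = proj_frac J P 0 1" if "P \<in> U" for P
  proof -
    have "proj_frac J P a k = proj_frac J P 0 1" if "(a, k) \<in> proj_frac {0} P g f" for a k
    proof -
      from that obtain d' e h where k: "homogeneous d' k" "k \<notin> P" and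
        h: "homogeneous e h" "h \<notin> P" "h * (g * k - a * f) = 0"
        unfolding proj_frac_def by blast
      have "h * f * a = (h * k) * g" using h(3) by (simp add: algebra_simps)
      then have "h * f * a \<in> J" using J g(1) unfolding ring_ideal_iff by metis
      moreover have "h * f \<notin> P" using h(2) fP[OF \<open>P \<in> U\<close>] unfolding prime_ideal_def by blast
      ultimately show ?thesis
        using proj_frac_eq_0[OF J _ k homogeneous_mult[OF h(1) f]] fP[OF \<open>P \<in> U\<close>] by blast
    qed
    then show ?thesis
      using self[OF that zero] that unfolding proj_stalk_map_def s_def by fastforce
  qed
  then have "s \<in> ideal_sheaf (Proj_quotient J) U"
    using s U by (auto simp: Proj_quotient_def proj_comorphism_def restrict_def fun_eq_iff)
  then have "proj_comorphism J' U s = (\<lambda>P \<in> U \<inter> proj_points J'. proj_frac J' P 0 1)"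
    unfolding eq using U by (simp add: Proj_quotient_def)
  from fun_cong[OF this, of ?P] have "proj_stalk_map J' ?P (s ?P) = proj_frac J' ?P 0 1"
    using P PU by (simp add: proj_comorphism_def)
  moreover have "(g, f) \<in> proj_stalk_map J' ?P (s ?P)"
    using self[OF PU zero] self[OF PU J'i] PU unfolding proj_stalk_map_def s_def by auto
  \<comment> \<open>At [p] the pair \<open>(g, f)\<close> belongs to the class of \<open>0/1\<close>
    modulo \<open>J'\<close>; unfolding this membership yields the multiplier, up to a sign.\<close>
  ultimately obtain e h where h: "homogeneous e h" "h \<notin> ?P" "h * (0 * f - g * 1) \<in> J'"
    unfolding proj_frac_def by blast
  have "(- 1) * (h * (0 * f - g * 1)) \<in> J'" using h(3) J'i unfolding ring_ideal_iff by blast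
  then have "h * g \<in> J'" by simp
  then show ?thesis using h homogeneous_in_line_ideal_iff by blast
qed


section \<open>Hyperplanes through a point\<close>

definition linear_hyperplane :: "(complex ^ 'n::finite) set \<Rightarrow> bool" where
  "linear_hyperplane H \<longleftrightarrow> vec.subspace H \<and> vec.dim H + 1 = CARD('n)"

text \<open>The sum of two distinct hyperplanes is strictly larger than either, hence the whole
  space, and the dimension formula applies.\<close>

lemma dim_Int_hyperplanes:
  fixes H K :: "(complex ^ 'n::finite) set"
  assumes "linear_hyperplane H" "linear_hyperplane K" "H \<noteq> K"
  shows "vec.dim (H \<inter> K) + 2 = CARD('n)"
proof -
  let ?S = "{x + y |x y. x \<in> H \<and> y \<in> K}"
  have sub: "vec.subspace H" "vec.subspace K" and dim: "vec.dim H + 1 = CARD('n)" "vec.dim K + 1 = CARD('n)"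
    using assms by (auto simp: linear_hyperplane_def)
  have S: "vec.subspace ?S" using sub by (rule vec.subspace_sums)
  have HS: "H \<subseteq> ?S"
  proof
    fix x assume "x \<in> H"
    then show "x \<in> ?S" using vec.subspace_0[OF sub(2)] by force
  qed
  have KS: "K \<subseteq> ?S"
  proof
    fix x assume "x \<in> K"
    then show "x \<in> ?S" using vec.subspace_0[OF sub(1)] by force
  qed
  have "\<not> vec.dim ?S \<le> vec.dim H"
  proof
    assume *: "vec.dim ?S \<le> vec.dim H"
    then have "H = ?S" using vec.subspace_dim_equal[OF sub(1) S HS] by blast
    moreover have "K = ?S" using vec.subspace_dim_equal[OF sub(2) S KS] * dim by linarith
    ultimately show False using assms(3) by metis
  qed
  moreover have "vec.dim ?S \<le> CARD('n)" by (rule dim_subset_UNIV_cart_gen)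
  ultimately show ?thesis using vec.dim_sums_Int[OF sub] dim by linarith
qed

lemma not_subset_zero_if_dim_pos:
  fixes S :: "(complex ^ 'n::finite) set"
  assumes "vec.dim S > 0"
  shows "\<not> S \<subseteq> {0}"
  using assms by (metis less_irrefl vec.dim_eq_0)

text \<open>A generic point of \<open>X\<close> lies only on the hyperplanes that contain \<open>X\<close>.\<close>

lemma card_containing_eq:
  fixes X :: "(complex ^ 'n::finite) set"
  assumes fin: "finite A" "finite B"
    and hyp: "\<And>H. H \<in> A \<union> B \<Longrightarrow> linear_hyperplane H"
    and le: "\<And>p. p \<noteq> 0 \<Longrightarrow> card {H \<in> A. p \<in> H} \<le> max (card {H \<in> B. p \<in> H}) 1"
      "\<And>p. p \<noteq> 0 \<Longrightarrow> card {H \<in> B. p \<in> H} \<le> max (card {H \<in> A. p \<in> H}) 1"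
    and X: "vec.subspace X" "\<not> X \<subseteq> {0}" and two: "card {H \<in> A. X \<subseteq> H} \<ge> 2"
  shows "card {H \<in> B. X \<subseteq> H} = card {H \<in> A. X \<subseteq> H}"
proof -
  \<comment> \<open>Adding the zero subspace to the family to be avoided makes \<open>p\<close>
    nonzero.\<close>
  have "\<exists>p\<in>X. \<forall>H\<in>insert {0} {H \<in> A \<union> B. \<not> X \<subseteq> H}. p \<notin> H"
    by (rule subspace_avoid) (use fin hyp X in \<open>auto simp: linear_hyperplane_def\<close>)
  then obtain p where p: "p \<in> X" "p \<noteq> 0" "\<And>H. H \<in> A \<union> B \<Longrightarrow> p \<in> H \<Longrightarrow> X \<subseteq> H" by auto
  have "{H \<in> A. p \<in> H} = {H \<in> A. X \<subseteq> H}" "{H \<in> B. p \<in> H} = {H \<in> B. X \<subseteq> H}"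
    using p by auto
  \<comment> \<open>At least two members of \<open>A\<close> pass through \<open>p\<close>, so the
    bound 1 in the maxima never takes effect.\<close>
  then show ?thesis using le[of p] p(2) two by auto
qed

lemma card_less_of_not_mem:
  fixes A B :: "(complex ^ 'n::finite) set set"
  assumes n: "CARD('n) \<ge> 3" and fin: "finite A" "finite B"
    and hyp: "\<And>H. H \<in> A \<union> B \<Longrightarrow> linear_hyperplane H"
    and ess: "\<Inter>A = {0}"
    and le: "\<And>p. p \<noteq> 0 \<Longrightarrow> card {H \<in> A. p \<in> H} \<le> max (card {H \<in> B. p \<in> H}) 1"
      "\<And>p. p \<noteq> 0 \<Longrightarrow> card {H \<in> B. p \<in> H} \<le> max (card {H \<in> A. p \<in> H}) 1"
    and H: "H \<in> A" "H \<notin> B"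
  shows "card A < card B"
proof -
  \<comment> \<open>The rank two flats of \<open>A\<close> inside \<open>H\<close>, as traces on
    \<open>H\<close> of the other members.\<close>
  define L where "L = (\<lambda>K. H \<inter> K) ` (A - {H})"
  define F where "F C X = {K \<in> C. X \<subseteq> K}" for C and X :: "(complex ^ 'n) set"
  have finL: "finite L" using fin by (simp add: L_def)
  have X: "vec.subspace X \<and> vec.dim X + 2 = CARD('n) \<and> \<not> X \<subseteq> {0} \<and> X \<subseteq> H" if "X \<in> L" for X
  proof -
    from that obtain K where K: "K \<in> A" "K \<noteq> H" "X = H \<inter> K" by (auto simp: L_def)
    have d: "vec.dim X + 2 = CARD('n)" using dim_Int_hyperplanes hyp K H by blast
    then have "\<not> X \<subseteq> {0}" using n by (intro not_subset_zero_if_dim_pos) simp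
    moreover have "vec.subspace X"
      using hyp K H by (auto simp: linear_hyperplane_def intro: vec.subspace_inter)
    ultimately show ?thesis using d K by blast
  qed
  \<comment> \<open>By dimension, a hyperplane other than \<open>H\<close> determines the flat in
    \<open>L\<close> that it contains. Both disjointness claims below rest on this; members of
    \<open>B\<close> differ from \<open>H\<close> because \<open>H\<close> is not in
    \<open>B\<close>.\<close>
  have meet: "H \<inter> K = X" if "X \<in> L" "X \<subseteq> K" "K \<in> A \<union> B" "K \<noteq> H" for X K
  proof -
    have "X \<subseteq> H \<inter> K" using X[OF that(1)] that(2) by blast
    moreover have "vec.dim (H \<inter> K) + 2 = CARD('n)" using dim_Int_hyperplanes hyp that H by blast
    moreover have "vec.subspace (H \<inter> K)"
      using hyp that H by (auto simp: linear_hyperplane_def intro: vec.subspace_inter)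
    ultimately show ?thesis using X[OF that(1)] vec.subspace_dim_equal[of X "H \<inter> K"] by simp
  qed
  \<comment> \<open>The two counts through \<open>X\<close> agree, but \<open>H\<close> is counted
    only in \<open>A\<close>; this is the extra 1.\<close>
  have card_eq: "card (F B X) = card (F A X - {H}) + 1" if "X \<in> L" for X
  proof -
    from that obtain K where K: "K \<in> A" "K \<noteq> H" "X = H \<inter> K" by (auto simp: L_def)
    have HF: "H \<in> F A X" and finF: "finite (F A X)" using K H fin by (auto simp: F_def)
    have "card {H, K} \<le> card (F A X)"
      by (rule card_mono) (use K H fin in \<open>auto simp: F_def\<close>)
    then have "card (F A X) \<ge> 2" using K by simp
    then have "card (F B X) = card (F A X)"
      unfolding F_def using card_containing_eq[OF fin hyp le] X[OF that] by blast
    then show ?thesis using card.remove[OF finF HF] by simp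
  qed
  \<comment> \<open>With fewer than two flats all of \<open>A\<close> would contain a nonzero
    subspace: \<open>H\<close> itself or the only flat, which has dimension at least 1 because
    \<open>CARD('n)\<close> is at least 3.\<close>
  have "card L \<ge> 2"
  proof (rule ccontr)
    assume "\<not> card L \<ge> 2"
    then have "card L = 0 \<or> card L = 1" by auto
    then have "\<exists>X. \<not> X \<subseteq> {0} \<and> (\<forall>K\<in>A. X \<subseteq> K)"
    proof
      assume "card L = 0"
      then have "A = {H}" using finL H by (auto simp: L_def)
      moreover have "\<not> H \<subseteq> {0}"
        using hyp H n by (intro not_subset_zero_if_dim_pos) (force simp: linear_hyperplane_def)
      ultimately show ?thesis by blast
    next
      assume "card L = 1"
      then obtain X0 where X0: "L = {X0}" by (auto simp: card_1_singleton_iff)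
      have "X0 \<subseteq> K" if "K \<in> A" for K
      proof (cases "K = H")
        case False
        then have "H \<inter> K \<in> L" using that by (auto simp: L_def)
        then show ?thesis using X0 by blast
      qed (use X X0 in blast)
      then show ?thesis using X X0 by blast
    qed
    then show False using ess by auto
  qed
  have disjA: "(F A X - {H}) \<inter> (F A Y - {H}) = {}" if "X \<in> L" "Y \<in> L" "X \<noteq> Y" for X Y
  proof (rule equals0I)
    fix K assume "K \<in> (F A X - {H}) \<inter> (F A Y - {H})"
    then have K: "X \<subseteq> K" "Y \<subseteq> K" "K \<in> A \<union> B" "K \<noteq> H" using H(2) by (auto simp: F_def)
    show False using meet[OF that(1) K(1,3,4)] meet[OF that(2) K(2-4)] that(3) by simp
  qed
  have disjB: "F B X \<inter> F B Y = {}" if "X \<in> L" "Y \<in> L" "X \<noteq> Y" for X Y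
  proof (rule equals0I)
    fix K assume "K \<in> F B X \<inter> F B Y"
    then have K: "X \<subseteq> K" "Y \<subseteq> K" "K \<in> A \<union> B" "K \<noteq> H" using H(2) by (auto simp: F_def)
    show False using meet[OF that(1) K(1,3,4)] meet[OF that(2) K(2-4)] that(3) by simp
  qed
  have "A - {H} \<subseteq> (\<Union>X\<in>L. F A X - {H})" by (auto simp: L_def F_def)
  then have "card (A - {H}) \<le> card (\<Union>X\<in>L. F A X - {H})"
    by (rule card_mono[rotated]) (use finL fin in \<open>auto simp: F_def\<close>)
  also have "\<dots> = (\<Sum>X\<in>L. card (F A X - {H}))"
    by (rule card_UN_disjoint) (use finL fin disjA in \<open>auto simp: F_def\<close>)
  finally have 1: "card (A - {H}) \<le> (\<Sum>X\<in>L. card (F A X - {H}))" .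
  have "(\<Sum>X\<in>L. card (F B X)) = card (\<Union>X\<in>L. F B X)"
    by (rule card_UN_disjoint[symmetric]) (use finL fin disjB in \<open>auto simp: F_def\<close>)
  also have "\<dots> \<le> card B" by (rule card_mono) (use fin in \<open>auto simp: F_def\<close>)
  \<comment> \<open>Each flat contributes one more to \<open>B\<close> than to
    \<open>A - {H}\<close>. As there are at least two flats, this outweighs the single hyperplane
    \<open>H\<close>.\<close>
  finally have "(\<Sum>X\<in>L. card (F A X - {H})) + card L \<le> card B" by (simp add: card_eq sum_Suc)
  then show ?thesis using 1 \<open>card L \<ge> 2\<close> card.remove[OF fin(1) H(1)] by simp
qed

text \<open>If only one inclusion fails, the strict inequality contradicts the other inclusion; if
  both fail, the two strict inequalities contradict each other.\<close>

lemma arrangement_eq_of_card_through: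
  fixes A B :: "(complex ^ 'n::finite) set set"
  assumes n: "CARD('n) \<ge> 3" and fin: "finite A" "finite B"
    and hyp: "\<And>H. H \<in> A \<union> B \<Longrightarrow> linear_hyperplane H"
    and ess: "\<Inter>A = {0}" "\<Inter>B = {0}"
    and le: "\<And>p. p \<noteq> 0 \<Longrightarrow> card {H \<in> A. p \<in> H} \<le> max (card {H \<in> B. p \<in> H}) 1"
      "\<And>p. p \<noteq> 0 \<Longrightarrow> card {H \<in> B. p \<in> H} \<le> max (card {H \<in> A. p \<in> H}) 1"
  shows "A = B"
proof -
  have hyp': "\<And>H. H \<in> B \<union> A \<Longrightarrow> linear_hyperplane H" using hyp by blast
  have AB: "card A < card B" if "\<not> A \<subseteq> B"
    using card_less_of_not_mem[OF n fin hyp ess(1) le] that by blast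
  have BA: "card B < card A" if "\<not> B \<subseteq> A"
    using card_less_of_not_mem[OF n fin(2,1) hyp' ess(2) le(2,1)] that by blast
  show ?thesis
    using AB BA card_mono[OF fin(2), of A] card_mono[OF fin(1), of B] by fastforce
qed


section \<open>The reconstruction\<close>

lemma defining_form_linear_hyperplane:
  assumes "arrangement A" "central A" "H \<in> A"
  shows "homogeneous 1 (defining_form H)" "poly_eval (defining_form H) v = 0 \<longleftrightarrow> v \<in> H"
    "linear_hyperplane H"
proof -
  have H: "hyperplane H" "0 \<in> H" using assms by (auto simp: arrangement_def central_def)
  show "homogeneous 1 (defining_form H)" "poly_eval (defining_form H) v = 0 \<longleftrightarrow> v \<in> H"
    using defining_form[OF H] by (auto simp: is_form_of_def)
  show "linear_hyperplane H"
    using hyperplane_through_0[OF H] by (simp add: linear_hyperplane_def)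
qed

lemma linear_hyperplane_proper: "linear_hyperplane H \<Longrightarrow> H \<noteq> UNIV"
  using vec_dim_card by (metis linear_hyperplane_def add_cancel_right_right one_neq_zero)

text \<open>Polynomials whose restriction is divisible by a fixed power of t form an ideal, so the
  bound passes from the generators to the whole Jacobian ideal.\<close>

lemma monom_dvd_line_restrict_jacobian_ideal:
  assumes "arrangement A" "central A" "g \<in> jacobian_ideal A"
  shows "[:0, 1:] ^ (card {H \<in> A. p \<in> H} - 1) dvd line_restrict p v g"
proof -
  let ?I = "{g. [:0, 1:] ^ (card {H \<in> A. p \<in> H} - 1) dvd line_restrict p v g}"
  note form = defining_form_linear_hyperplane[OF assms(1,2)]
  have eq: "{H \<in> A. poly_eval (defining_form H) p = 0} = {H \<in> A. p \<in> H}" using form(2) by blast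
  have "ring_ideal ?I"
    unfolding ring_ideal_iff by (simp add: line_restrict_add line_restrict_mult)
  moreover have "range (\<lambda>i. partial_deriv i (defining_poly A)) \<subseteq> ?I"
    using monom_dvd_line_restrict_partial_deriv_prod[of A defining_form p v] form(1) assms(1)
    by (auto simp: arrangement_def defining_poly_def eq)
  ultimately show ?thesis
    using ideal_generated_least(3) assms(3) unfolding jacobian_ideal_def by blast
qed

text \<open>A partial derivative \<open>g\<close> of least order in \<open>J(B)\<close> is carried
  into \<open>J(A)\<close> by a multiplier not vanishing at \<open>p\<close>, which leaves its order
  unchanged. The maximum with 1 is there because the Jacobian ideal has order zero both off the
  arrangement and at points on exactly one hyperplane.\<close>

lemma card_through_le:
  fixes A B :: "(complex ^ 'n::finite) set set"
  assumes A: "arrangement A" "central A" and B: "arrangement B" "central B" "B \<noteq> {}"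
    and eq: "jacobian_scheme A = jacobian_scheme B" and p: "p \<noteq> 0"
  shows "card {H \<in> A. p \<in> H} \<le> max (card {H \<in> B. p \<in> H}) 1"
proof -
  note form = defining_form_linear_hyperplane[OF B(1,2)]
  have finA: "finite A" and fin: "finite B" using A B by (auto simp: arrangement_def)
  have "\<exists>v. poly_eval (defining_form H) v \<noteq> 0" if "H \<in> B" for H
    using form[OF that] linear_hyperplane_proper[of H] by auto
  then have "\<exists>i v. \<not> [:0, 1:] ^ max (card {H \<in> B. poly_eval (defining_form H) p = 0}) 1 dvd
      line_restrict p v (partial_deriv i (defining_poly B))"
    unfolding defining_poly_def by (intro exists_partial_deriv_prod_not_monom_dvd fin B(3) form(1))
  moreover have "{H \<in> B. poly_eval (defining_form H) p = 0} = {H \<in> B. p \<in> H}"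
    using form(2) by blast
  ultimately obtain i v where iv: "\<not> [:0, 1:] ^ max (card {H \<in> B. p \<in> H}) 1 dvd
      line_restrict p v (partial_deriv i (defining_poly B))"
    by auto
  define g where "g = partial_deriv i (defining_poly B)"
  have hom: "homogeneous (card C - 1) (partial_deriv j (defining_poly C))"
    if C: "arrangement C" "central C" for j and C :: "(complex ^ 'n) set set"
    unfolding defining_poly_def
    by (intro homogeneous_partial_deriv homogeneous_prod_linear_forms)
      (use defining_form_linear_hyperplane(1)[OF C] C(1) in \<open>auto simp: arrangement_def\<close>)
  have gJ: "g \<in> jacobian_ideal B"
    unfolding jacobian_ideal_def g_def by (intro subsetD[OF ideal_generated_least(2)] rangeI)
  have "ring_ideal (jacobian_ideal B)"
    unfolding jacobian_ideal_def by (rule ideal_generated_least)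
  moreover have "Proj_quotient (jacobian_ideal B) = Proj_quotient (jacobian_ideal A)"
    using eq by (simp add: jacobian_scheme_def)
  moreover have "\<exists>d. homogeneous d b" if "b \<in> range (\<lambda>i. partial_deriv i (defining_poly A))" for b
    using hom[OF A] that by blast
  ultimately have "\<exists>h. poly_eval h p \<noteq> 0 \<and> h * g \<in> jacobian_ideal A"
    using Proj_quotient_eq_imp_locally_in[OF _ _ jacobian_ideal_def _ gJ _ p, of A]
      hom[OF B(1,2), of i, folded g_def] by simp
  then obtain h where h: "poly_eval h p \<noteq> 0" "h * g \<in> jacobian_ideal A" by blast
  let ?h = "line_restrict p v h" and ?g = "line_restrict p v g"
  \<comment> \<open>The restriction at t = 0 is the value at \<open>p\<close>, so the multiplier has
    order zero.\<close>
  have "poly ?h 0 \<noteq> 0" using h(1) by (simp add: poly_line_restrict)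
  then have h0: "?h \<noteq> 0" "order 0 ?h = 0" by (auto simp: order_0I)
  note order_dvd = order_divides[of 0, unfolded minus_zero]
  have "\<not> (?g = 0 \<or> max (card {H \<in> B. p \<in> H}) 1 \<le> order 0 ?g)"
    using iv unfolding order_dvd g_def .
  then have g0: "?g \<noteq> 0" "order 0 ?g < max (card {H \<in> B. p \<in> H}) 1" by linarith+
  have "[:0, 1:] ^ (card {H \<in> A. p \<in> H} - 1) dvd ?h * ?g"
    using monom_dvd_line_restrict_jacobian_ideal[OF A h(2)] unfolding line_restrict_mult .
  then have "card {H \<in> A. p \<in> H} - 1 \<le> order 0 (?h * ?g)"
    unfolding order_dvd using h0(1) g0(1) by simp
  also have "\<dots> = order 0 ?g" using h0 g0(1) by (simp add: order_mult)
  finally have "card {H \<in> A. p \<in> H} - 1 \<le> order 0 ?g" .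
  then show ?thesis using g0(2) by linarith
qed

section \<open>Rescaling the defining polynomial, and the theorem\<close>

lemma partial_deriv_const_mult: "partial_deriv i (const c * q) = const c * partial_deriv i q"
  by (simp add: partial_deriv_mult const_def partial_deriv_single)

lemma jacobian_ideal_subset_of_scalar:
  assumes "defining_poly A = const c * defining_poly B"
  shows "jacobian_ideal A \<subseteq> jacobian_ideal B"
  unfolding jacobian_ideal_def
proof (rule ideal_generated_least(3)[OF ideal_generated_least(1)])
  have "partial_deriv i (defining_poly A) \<in> ideal_generated (range (\<lambda>i. partial_deriv i (defining_poly B)))" for i
    unfolding assms partial_deriv_const_mult
    using ideal_generated_least(1,2)[of "range (\<lambda>i. partial_deriv i (defining_poly B))"]
    unfolding ring_ideal_iff by blast
  then show "range (\<lambda>i. partial_deriv i (defining_poly A)) \<subseteq>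
      ideal_generated (range (\<lambda>i. partial_deriv i (defining_poly B)))" by blast
qed

theorem theorem1p1:
  fixes A\<^sub>1 A\<^sub>2 :: "(complex ^ 'n::finite) set set"
  assumes "CARD('n) \<ge> 3"
    and "arrangement A\<^sub>1" "central A\<^sub>1" "essential A\<^sub>1"
    and "arrangement A\<^sub>2" "central A\<^sub>2" "essential A\<^sub>2"
  shows "identical A\<^sub>1 A\<^sub>2 \<longleftrightarrow> jacobian_scheme A\<^sub>1 = jacobian_scheme A\<^sub>2"
proof
  assume "identical A\<^sub>1 A\<^sub>2"
  then obtain c where c: "c \<noteq> 0" "defining_poly A\<^sub>1 = const c * defining_poly A\<^sub>2"
    by (auto simp: identical_def)
  have "const (inverse c) * const c = (1 :: 'n cpoly)" using c(1) by (simp add: const_def mult_single)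
  then have "defining_poly A\<^sub>2 = const (inverse c) * defining_poly A\<^sub>1"
    unfolding c(2) by (simp flip: mult.assoc)
  then have "jacobian_ideal A\<^sub>1 = jacobian_ideal A\<^sub>2"
    using jacobian_ideal_subset_of_scalar c(2) by (metis subset_antisym)
  then show "jacobian_scheme A\<^sub>1 = jacobian_scheme A\<^sub>2" by (simp add: jacobian_scheme_def)
next
  assume eq: "jacobian_scheme A\<^sub>1 = jacobian_scheme A\<^sub>2"
  have ess: "\<Inter>A\<^sub>1 = {0}" "\<Inter>A\<^sub>2 = {0}" using assms by (auto simp: essential_def)
  \<comment> \<open>The empty family has intersection \<open>UNIV\<close>, so an essential
    arrangement here is nonempty.\<close>
  have "(1 :: complex ^ 'n) \<noteq> 0" by simp
  then have "(UNIV :: (complex ^ 'n) set) \<noteq> {0}" by blast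
  then have ne: "A\<^sub>1 \<noteq> {}" "A\<^sub>2 \<noteq> {}" using ess by auto
  have fin: "finite A\<^sub>1" "finite A\<^sub>2" using assms by (auto simp: arrangement_def)
  have hyp: "linear_hyperplane H" if "H \<in> A\<^sub>1 \<union> A\<^sub>2" for H
    using defining_form_linear_hyperplane(3) that assms by blast
  have "A\<^sub>1 = A\<^sub>2"
    by (rule arrangement_eq_of_card_through[OF assms(1) fin hyp ess
          card_through_le[OF assms(2,3,5,6) ne(2) eq] card_through_le[OF assms(5,6,2,3) ne(1) eq[symmetric]]])
  \<comment> \<open>Equal sets have literally the same \<open>defining_poly\<close>, hence the
    scalar 1.\<close>
  then show "identical A\<^sub>1 A\<^sub>2" unfolding identical_def by (intro exI[of _ 1]) (simp add: const_def)
qed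

end
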